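(* Let $n$ be odd and let $s_5(T)$ denote the number of $5$-element vertex subsets of a tournament $T$ inducing a strongly connected subtournament. For each odd $n\ge 9$, the maximum of $s_5(T)$ over all tournaments $T$ of order $n$ equals $\frac{(n+1)n(n-1)(n-3)(11n-47)}{1920}$ and is attained only at $T\cong RLT_n$. For $n=7$, the maximum is attained at $RLT_7$ and also at $DR_7$ and $Kz_7$.
   Context: A tournament is an orientation of a complete graph. $RLT_n$ (regular locally transitive tournament, $n$ odd) has vertex set $\mathbb{Z}_n$ with $i\to j$ iff $j-i\in\{1,\dots,\frac{n-1}{2}\}$ (mod $n$). A tournament is regular if all out-degrees equal $\frac{n-1}{2}$. $DR_7$ is the unique doubly regular tournament of order $7$ (regular, and the out-set of every vertex induces a regular subtournament). $\Delta$ denotes the cyclic triple (strong tournament on 3 vertices), $TT_2$ the tournament on 2 vertices, and $\Delta\cdot TT_2$ the 6-vertex tournament obtained from $\Delta$ by replacing each vertex by a copy of $TT_2$, with all arcs between copies oriented as the corresponding arc of $\Delta$. $Kz_7$ (the Kotzig tournament) is the unique regular tournament of order $7$ having $\Delta\cdot TT_2$ as a one-vertex-deleted subtournament. *)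

theory Defs
  imports Complex_Main
begin

text \<open>A tournament of order n: vertex set {0..<n}; T i j means the arc i -> j.
  Values of T outside {0..<n} are irrelevant.\<close>
definition tournament :: "nat \<Rightarrow> (nat \<Rightarrow> nat \<Rightarrow> bool) \<Rightarrow> bool" where
  "tournament n T \<longleftrightarrow> (\<forall>i<n. \<not> T i i) \<and>
     (\<forall>i<n. \<forall>j<n. i \<noteq> j \<longrightarrow> (T i j \<longleftrightarrow> \<not> T j i))"

definition iso_on :: "'a set \<Rightarrow> ('a \<Rightarrow> 'a \<Rightarrow> bool) \<Rightarrow> 'b set \<Rightarrow> ('b \<Rightarrow> 'b \<Rightarrow> bool) \<Rightarrow> bool" where
  "iso_on A T B U \<longleftrightarrow> (\<exists>f. bij_betw f A B \<and> (\<forall>x\<in>A. \<forall>y\<in>A. T x y \<longleftrightarrow> U (f x) (f y)))"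

definition tiso :: "nat \<Rightarrow> (nat \<Rightarrow> nat \<Rightarrow> bool) \<Rightarrow> (nat \<Rightarrow> nat \<Rightarrow> bool) \<Rightarrow> bool" where
  "tiso n T U \<longleftrightarrow> iso_on {0..<n} T {0..<n} U"

definition strong_on :: "(nat \<Rightarrow> nat \<Rightarrow> bool) \<Rightarrow> nat set \<Rightarrow> bool" where
  "strong_on T S \<longleftrightarrow>
     (\<forall>u\<in>S. \<forall>v\<in>S. (u, v) \<in> {(x, y). x \<in> S \<and> y \<in> S \<and> T x y}\<^sup>*)"

definition s5 :: "nat \<Rightarrow> (nat \<Rightarrow> nat \<Rightarrow> bool) \<Rightarrow> nat" where
  "s5 n T = card {S. S \<subseteq> {0..<n} \<and> card S = 5 \<and> strong_on T S}"

definition rlt :: "nat \<Rightarrow> nat \<Rightarrow> nat \<Rightarrow> bool" where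
  "rlt n i j \<longleftrightarrow> 1 \<le> (j + n - i) mod n \<and> (j + n - i) mod n \<le> (n - 1) div 2"

definition regular :: "nat \<Rightarrow> (nat \<Rightarrow> nat \<Rightarrow> bool) \<Rightarrow> bool" where
  "regular n T \<longleftrightarrow> tournament n T \<and> (\<forall>i<n. card {j. j < n \<and> T i j} = (n - 1) div 2)"

definition doubly_regular :: "nat \<Rightarrow> (nat \<Rightarrow> nat \<Rightarrow> bool) \<Rightarrow> bool" where
  "doubly_regular n T \<longleftrightarrow> regular n T \<and>
     (\<forall>v<n. let N = {j. j < n \<and> T v j} in
        \<forall>u\<in>N. card {w \<in> N. T u w} = (card N - 1) div 2)"

text \<open>Delta . TT_2 on {0..<6}: vertex k lies in copy k div 2 (a vertex of the cyclic
  triple 0 -> 1 -> 2 -> 0), with position k mod 2 inside the copy of TT_2 (0 -> 1).\<close>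
definition delta_tt2 :: "nat \<Rightarrow> nat \<Rightarrow> bool" where
  "delta_tt2 x y \<longleftrightarrow>
     (if x div 2 = y div 2 then x mod 2 = 0 \<and> y mod 2 = 1
      else y div 2 = (x div 2 + 1) mod 3)"

definition kotzig :: "nat \<Rightarrow> (nat \<Rightarrow> nat \<Rightarrow> bool) \<Rightarrow> bool" where
  "kotzig n T \<longleftrightarrow> regular n T \<and>
     (\<exists>v<n. iso_on ({0..<n} - {v}) T {0..<6::nat} delta_tt2)"

definition s5_max :: "nat \<Rightarrow> (nat \<Rightarrow> nat \<Rightarrow> bool) \<Rightarrow> bool" where
  "s5_max n T \<longleftrightarrow> tournament n T \<and> (\<forall>U. tournament n U \<longrightarrow> s5 n U \<le> s5 n T)"

end

theory Submission
  imports Defs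
begin

text \<open>A 5-set of vertices fails to induce a strong subtournament exactly when it has a source or a
  sink. The 5-sets with a source number \<open>\<Sum>\<^sub>v C(d\<^sup>+(v), 4)\<close>, those with a sink
  \<open>\<Sum>\<^sub>v C(d\<^sup>-(v), 4)\<close>; as \<open>d\<^sup>+(v) + d\<^sup>-(v) = 2k\<close> for \<open>n = 2k + 1\<close>, convexity of
  \<open>C(-, 4)\<close> makes the two counts add up to at least \<open>2 n C(k, 4)\<close>. Hence at least \<open>n C(k, 4)\<close>
  5-sets are not strong, with equality only if \<open>T\<close> is regular and a 5-set has a source iff it has
  a sink. For \<open>k \<ge> 4\<close> the latter excludes cyclic triples from all out-neighbourhoods, and a
  regular tournament with transitive out-neighbourhoods is \<open>RLT\<^sub>n\<close>: a vertex, its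
  out-neighbours and its in-neighbours, the latter two ordered by rank, occupy consecutive
  positions. All in-neighbourhoods of \<open>RLT\<^sub>n\<close> are transitive, so \<open>RLT\<^sub>n\<close> attains the bound.
  For \<open>n = 7\<close> a regular tournament has all degrees \<open>3 < 4\<close>, so every 5-set is strong.\<close>

text \<open>Sinks of \<open>T\<close> are the sources in \<open>dual T\<close>, and in-neighbourhoods are \<open>out_nbrs (dual T)\<close>.\<close>
definition dual :: "('a \<Rightarrow> 'a \<Rightarrow> bool) \<Rightarrow> 'a \<Rightarrow> 'a \<Rightarrow> bool" where
  "dual T i j \<longleftrightarrow> T j i"

lemma dual_apply [simp]: "dual T i j \<longleftrightarrow> T j i"
  by (simp add: dual_def)

lemma dual_dual [simp]: "dual (dual T) = T"
  by (simp add: fun_eq_iff)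

lemma tournament_dual: "tournament n T \<Longrightarrow> tournament n (dual T)"
  unfolding tournament_def dual_apply by blast

lemma tournament_irrefl: "tournament n T \<Longrightarrow> i < n \<Longrightarrow> \<not> T i i"
  unfolding tournament_def by blast

lemma tournament_asym: "tournament n T \<Longrightarrow> i < n \<Longrightarrow> j < n \<Longrightarrow> T i j \<Longrightarrow> \<not> T j i"
  unfolding tournament_def by blast

lemma tournament_total: "tournament n T \<Longrightarrow> i < n \<Longrightarrow> j < n \<Longrightarrow> i \<noteq> j \<Longrightarrow> \<not> T i j \<Longrightarrow> T j i"
  unfolding tournament_def by blast

definition out_nbrs :: "(nat \<Rightarrow> nat \<Rightarrow> bool) \<Rightarrow> nat \<Rightarrow> nat \<Rightarrow> nat set" where
  "out_nbrs T n v = {j. j < n \<and> T v j}"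

lemma finite_out_nbrs [simp]: "finite (out_nbrs T n v)"
  by (simp add: out_nbrs_def)

lemma card_out_plus_in_within:
  assumes T: "tournament n T" and Y: "Y \<subseteq> {0..<n}" and y: "y \<in> Y"
  shows "card {z \<in> Y. T y z} + card {z \<in> Y. T z y} = card Y - 1"
proof -
  have fin: "finite Y" using Y finite_subset by blast
  have Yn: "z < n" if "z \<in> Y" for z using Y that by auto
  have "{z \<in> Y. T y z} \<union> {z \<in> Y. T z y} = Y - {y}"
    using Yn y tournament_irrefl[OF T] tournament_total[OF T] by blast
  moreover have "{z \<in> Y. T y z} \<inter> {z \<in> Y. T z y} = {}"
    using Yn y tournament_asym[OF T] by blast
  ultimately have "card {z \<in> Y. T y z} + card {z \<in> Y. T z y} = card (Y - {y})"
    using fin by (metis (no_types, lifting) card_Un_disjoint finite_Diff finite_Un)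
  then show ?thesis using y fin by simp
qed

lemma card_out_plus_in:
  assumes "tournament n T" and "v < n"
  shows "card (out_nbrs T n v) + card (out_nbrs (dual T) n v) = n - 1"
  using card_out_plus_in_within[OF assms(1), of "{0..<n}" v] assms(2)
  by (simp add: out_nbrs_def)

section \<open>Sources, sinks and strong connectivity\<close>

definition source_in :: "(nat \<Rightarrow> nat \<Rightarrow> bool) \<Rightarrow> nat set \<Rightarrow> nat \<Rightarrow> bool" where
  "source_in T S v \<longleftrightarrow> v \<in> S \<and> (\<forall>x\<in>S. x \<noteq> v \<longrightarrow> T v x)"

lemma source_in_unique:
  assumes T: "tournament n T" and S: "S \<subseteq> {0..<n}"
    and "source_in T S v" "source_in T S w"
  shows "v = w"
proof (rule ccontr)
  assume "v \<noteq> w"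
  then have "T v w" "T w v" using assms(3,4) unfolding source_in_def by auto
  moreover have "v < n" "w < n" using assms(3,4) S unfolding source_in_def by auto
  ultimately show False using tournament_asym[OF T] by blast
qed

lemma strong_on_dual: "strong_on (dual T) S \<longleftrightarrow> strong_on T S"
proof -
  have "{(x, y). x \<in> S \<and> y \<in> S \<and> dual T x y} = {(x, y). x \<in> S \<and> y \<in> S \<and> T x y}\<inverse>"
    by auto
  then show ?thesis unfolding strong_on_def by (auto simp: rtrancl_converse)
qed

lemma source_not_strong_on:
  assumes T: "tournament n T" and S: "S \<subseteq> {0..<n}" "2 \<le> card S"
    and v: "source_in T S v"
  shows "\<not> strong_on T S"
proof
  assume strong: "strong_on T S"
  have vS: "v \<in> S" using v by (simp add: source_in_def)
  have "\<not> S \<subseteq> {v}"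
  proof
    assume "S \<subseteq> {v}"
    then have "card S \<le> 1" using card_mono[of "{v}" S] by simp
    with S(2) show False by simp
  qed
  then obtain x where x: "x \<in> S" "x \<noteq> v" by blast
  have "(x, v) \<in> {(x, y). x \<in> S \<and> y \<in> S \<and> T x y}\<^sup>*"
    using strong x vS unfolding strong_on_def by blast
  then show False
  proof (cases rule: rtranclE)
    case base
    then show ?thesis using x by simp
  next
    case (step y)
    then have "y \<in> S" "T y v" by auto
    moreover have "y \<noteq> v" using \<open>T y v\<close> tournament_irrefl[OF T] vS S by auto
    moreover have "v < n" "y < n" using vS \<open>y \<in> S\<close> S(1) by auto
    ultimately show False
      using v tournament_asym[OF T, of v y] unfolding source_in_def by blast
  qed
qed

lemma not_strong_on_split:
  assumes T: "tournament n T" and S: "S \<subseteq> {0..<n}" and "\<not> strong_on T S"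
  obtains A where "A \<subseteq> S" "A \<noteq> {}" "A \<noteq> S" "\<And>a b. a \<in> A \<Longrightarrow> b \<in> S - A \<Longrightarrow> T b a"
proof -
  let ?R = "{(x, y). x \<in> S \<and> y \<in> S \<and> T x y}"
  obtain u v where uv: "u \<in> S" "v \<in> S" "(u, v) \<notin> ?R\<^sup>*"
    using assms(3) unfolding strong_on_def by blast
  define A where "A = {y \<in> S. (u, y) \<in> ?R\<^sup>*}"
  show ?thesis
  proof (rule that)
    show "A \<subseteq> S" "A \<noteq> {}" "A \<noteq> S" using uv by (auto simp: A_def)
    show "T b a" if "a \<in> A" "b \<in> S - A" for a b
    proof (rule tournament_total[OF T])
      show "\<not> T a b"
        using that rtrancl_into_rtrancl[of u a ?R b] unfolding A_def by auto
    qed (use that S in \<open>auto simp: A_def\<close>)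
  qed
qed

lemma small_set_has_source:
  assumes T: "tournament n T" and A: "A \<subseteq> {0..<n}" "A \<noteq> {}" "card A \<le> 2"
  obtains q where "source_in T A q"
proof -
  have "finite A" using A(1) finite_subset by blast
  then have "card A = 1 \<or> card A = 2" using A(2,3) by (cases "card A") auto
  then consider q where "A = {q}" | p q where "A = {p, q}" "p \<noteq> q"
    by (metis card_1_singletonE card_2_iff)
  then show ?thesis
  proof cases
    case 1
    then show ?thesis using that by (simp add: source_in_def)
  next
    case 2
    then have "T p q \<or> T q p" using A(1) tournament_total[OF T, of p q] by auto
    then show ?thesis using that 2 unfolding source_in_def by auto
  qed
qed

text \<open>A non-strong set splits as \<open>S - A \<rightarrow> A\<close>; when \<open>card S \<le> 5\<close> one of the two parts has at
  most two vertices, and its source (or sink) is a source (or sink) of \<open>S\<close>.\<close>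
lemma strong_on_iff_no_source_sink:
  assumes T: "tournament n T" and S: "S \<subseteq> {0..<n}" "2 \<le> card S" "card S \<le> 5"
  shows "strong_on T S \<longleftrightarrow> \<not> (\<exists>v. source_in T S v) \<and> \<not> (\<exists>v. source_in (dual T) S v)"
proof
  assume "strong_on T S"
  then show "\<not> (\<exists>v. source_in T S v) \<and> \<not> (\<exists>v. source_in (dual T) S v)"
    using source_not_strong_on[OF T S(1,2)] source_not_strong_on[OF tournament_dual[OF T] S(1,2)]
    by (auto simp: strong_on_dual)
next
  assume no: "\<not> (\<exists>v. source_in T S v) \<and> \<not> (\<exists>v. source_in (dual T) S v)"
  show "strong_on T S"
  proof (rule ccontr)
    assume "\<not> strong_on T S"
    then obtain A where A: "A \<subseteq> S" "A \<noteq> {}" "A \<noteq> S" and BA: "\<And>a b. a \<in> A \<Longrightarrow> b \<in> S - A \<Longrightarrow> T b a"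
      using not_strong_on_split[OF T S(1)] by blast
    have fin: "finite S" using S(1) finite_subset by blast
    have "card A + card (S - A) = card S"
      using A(1) fin by (metis card_Diff_subset card_mono finite_subset le_add_diff_inverse)
    then consider "card A \<le> 2" | "card (S - A) \<le> 2" using S(3) by linarith
    then show False
    proof cases
      case 1
      moreover have "A \<subseteq> {0..<n}" using A S(1) by auto
      ultimately obtain q where "source_in (dual T) A q"
        using small_set_has_source[OF tournament_dual[OF T], of A] A(2) by blast
      then have "source_in (dual T) S q" using A(1) BA unfolding source_in_def by auto
      then show False using no by blast
    next
      case 2
      moreover have "S - A \<subseteq> {0..<n}" "S - A \<noteq> {}" using A S(1) by auto
      ultimately obtain q where "source_in T (S - A) q"
        using small_set_has_source[OF T, of "S - A"] by blast
      then have "source_in T S q" using BA unfolding source_in_def by auto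
      then show False using no by blast
    qed
  qed
qed

section \<open>Counting non-strong 5-sets\<close>

definition sourced_sets :: "(nat \<Rightarrow> nat \<Rightarrow> bool) \<Rightarrow> nat \<Rightarrow> nat \<Rightarrow> nat set set" where
  "sourced_sets T n m = {S. S \<subseteq> {0..<n} \<and> card S = m \<and> (\<exists>v. source_in T S v)}"

definition non_strong_sets :: "(nat \<Rightarrow> nat \<Rightarrow> bool) \<Rightarrow> nat \<Rightarrow> nat set set" where
  "non_strong_sets T n = {S. S \<subseteq> {0..<n} \<and> card S = 5 \<and> \<not> strong_on T S}"

lemma finite_non_strong_sets: "finite (non_strong_sets T n)"
  by (rule finite_subset[of _ "Pow {0..<n}"]) (auto simp: non_strong_sets_def)

lemma non_strong_sets_eq:
  assumes "tournament n T"
  shows "non_strong_sets T n = sourced_sets T n 5 \<union> sourced_sets (dual T) n 5"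
  unfolding non_strong_sets_def sourced_sets_def
  using strong_on_iff_no_source_sink[OF assms] by auto

lemma s5_plus_card_non_strong_sets: "s5 n T + card (non_strong_sets T n) = n choose 5"
proof -
  let ?strong = "{S. S \<subseteq> {0..<n} \<and> card S = 5 \<and> strong_on T S}"
  have "?strong \<union> non_strong_sets T n = {S. S \<subseteq> {0..<n} \<and> card S = 5}"
    by (auto simp: non_strong_sets_def)
  moreover have "?strong \<inter> non_strong_sets T n = {}"
    by (auto simp: non_strong_sets_def)
  moreover have "finite ?strong"
    by (rule finite_subset[of _ "Pow {0..<n}"]) auto
  ultimately show ?thesis
    unfolding s5_def using n_subsets[of "{0..<n}" 5] finite_non_strong_sets
    by (metis card_Un_disjoint card_atLeastLessThan diff_zero finite_atLeastLessThan)
qed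

lemma bij_betw_sourced_sets:
  assumes T: "tournament n T"
  shows "bij_betw (\<lambda>(v, X). insert v X)
    (SIGMA v:{..<n}. {X. X \<subseteq> out_nbrs T n v \<and> card X = m}) (sourced_sets T n (Suc m))"
    (is "bij_betw ?f ?A _")
proof -
  have notin: "v \<notin> X" if "X \<subseteq> out_nbrs T n v" for v X
    using that tournament_irrefl[OF T] by (auto simp: out_nbrs_def)
  have source: "source_in T (insert v X) v" if "X \<subseteq> out_nbrs T n v" for v X
    using that by (auto simp: source_in_def out_nbrs_def)
  have "inj_on ?f ?A"
  proof (rule inj_onI, clarsimp)
    fix v w X Y
    assume v: "v < n" "X \<subseteq> out_nbrs T n v" and w: "w < n" "Y \<subseteq> out_nbrs T n w"
      and eq: "insert v X = insert w Y"
    have "insert v X \<subseteq> {0..<n}" using v by (auto simp: out_nbrs_def)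
    then have "v = w" using source_in_unique[OF T] source[OF v(2)] source[OF w(2)] eq by metis
    then show "v = w \<and> X = Y" using eq notin v(2) w(2) by (metis insert_ident)
  qed
  moreover have "?f ` ?A = sourced_sets T n (Suc m)"
  proof (intro equalityI subsetI)
    fix S assume "S \<in> ?f ` ?A"
    then obtain v X where vX: "v < n" "X \<subseteq> out_nbrs T n v" "card X = m" and S: "S = insert v X"
      by auto
    have "finite X" using vX(2) by (rule finite_subset) simp
    then have "card S = Suc m" using S vX notin by simp
    moreover have "S \<subseteq> {0..<n}" using S vX by (auto simp: out_nbrs_def)
    ultimately show "S \<in> sourced_sets T n (Suc m)"
      using source[OF vX(2)] S unfolding sourced_sets_def by blast
  next
    fix S assume "S \<in> sourced_sets T n (Suc m)"
    then obtain v where S: "S \<subseteq> {0..<n}" "card S = Suc m" and v: "source_in T S v"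
      unfolding sourced_sets_def by blast
    then have "v \<in> S" "S - {v} \<subseteq> out_nbrs T n v" "card (S - {v}) = m"
      by (auto simp: source_in_def out_nbrs_def)
    then show "S \<in> ?f ` ?A"
      using S by (intro image_eqI[of _ _ "(v, S - {v})"]) auto
  qed
  ultimately show ?thesis unfolding bij_betw_def ..
qed

lemma card_sourced_sets:
  assumes "tournament n T"
  shows "card (sourced_sets T n (Suc m)) = (\<Sum>v<n. card (out_nbrs T n v) choose m)"
proof -
  have "card (sourced_sets T n (Suc m))
      = card (SIGMA v:{..<n}. {X. X \<subseteq> out_nbrs T n v \<and> card X = m})"
    using bij_betw_same_card[OF bij_betw_sourced_sets[OF assms]] by simp
  also have "\<dots> = (\<Sum>v<n. card {X. X \<subseteq> out_nbrs T n v \<and> card X = m})"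
    by (rule card_SigmaI) (auto intro: finite_subset[of _ "Pow (out_nbrs T n _)"])
  also have "\<dots> = (\<Sum>v<n. card (out_nbrs T n v) choose m)"
    by (simp add: n_subsets)
  finally show ?thesis .
qed

lemma real_choose_4: "real (d choose 4) = real d * (real d - 1) * (real d - 2) * (real d - 3) / 24"
  by (simp add: binomial_gbinomial gbinomial_prod_rev numeral_eq_Suc prod.atLeast0_lessThan_Suc)

lemma real_choose_5:
  "real (d choose 5) = real d * (real d - 1) * (real d - 2) * (real d - 3) * (real d - 4) / 120"
  by (simp add: binomial_gbinomial gbinomial_prod_rev numeral_eq_Suc prod.atLeast0_lessThan_Suc)

text \<open>With \<open>d = k + t\<close>, the excess of \<open>C(d,4) + C(2k-d,4)\<close> over \<open>2 C(k,4)\<close> is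
  \<open>t\<^sup>2 (12 (k - 3/2)\<^sup>2 + 2 t\<^sup>2 - 5) / 24\<close>.\<close>
lemma choose_4_convex:
  assumes "d \<le> 2 * k" "3 \<le> k"
  shows "2 * (k choose 4) \<le> (d choose 4) + ((2 * k - d) choose 4)"
    and "d \<noteq> k \<Longrightarrow> 2 * (k choose 4) < (d choose 4) + ((2 * k - d) choose 4)"
proof -
  define t where "t = real d - real k"
  have "real (2 * k - d) = real k - t" using assms(1) by (simp add: t_def of_nat_diff)
  then have excess: "24 * (real (d choose 4) + real ((2 * k - d) choose 4) - 2 * real (k choose 4))
      = t\<^sup>2 * (12 * (real k - 3/2)\<^sup>2 + 2 * t\<^sup>2 - 5)"
    unfolding real_choose_4 by (simp add: t_def field_simps power2_eq_square)
  have "(3/2)\<^sup>2 \<le> (real k - 3/2)\<^sup>2" using assms(2) by (intro power_mono) simp_all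
  then have "9/4 \<le> (real k - 3/2)\<^sup>2" by (simp add: power2_eq_square)
  moreover have "0 \<le> t\<^sup>2" by simp
  ultimately have pos: "0 < 12 * (real k - 3/2)\<^sup>2 + 2 * t\<^sup>2 - 5" by linarith
  then have "0 \<le> t\<^sup>2 * (12 * (real k - 3/2)\<^sup>2 + 2 * t\<^sup>2 - 5)" by simp
  with excess have "real (2 * (k choose 4)) \<le> real ((d choose 4) + ((2 * k - d) choose 4))" by simp
  then show "2 * (k choose 4) \<le> (d choose 4) + ((2 * k - d) choose 4)" by (simp only: of_nat_le_iff)
  assume "d \<noteq> k"
  then have "0 < t\<^sup>2" by (simp add: t_def)
  with pos have "0 < t\<^sup>2 * (12 * (real k - 3/2)\<^sup>2 + 2 * t\<^sup>2 - 5)" by simp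
  with excess have "real (2 * (k choose 4)) < real ((d choose 4) + ((2 * k - d) choose 4))" by simp
  then show "2 * (k choose 4) < (d choose 4) + ((2 * k - d) choose 4)" by (simp only: of_nat_less_iff)
qed

lemma card_sourced_sets_plus_dual_ge:
  assumes T: "tournament n T" and n: "n = 2 * k + 1" and k: "3 \<le> k"
  shows "2 * (n * (k choose 4)) \<le> card (sourced_sets T n 5) + card (sourced_sets (dual T) n 5)"
    and "(\<exists>v<n. card (out_nbrs T n v) \<noteq> k) \<Longrightarrow>
      2 * (n * (k choose 4)) < card (sourced_sets T n 5) + card (sourced_sets (dual T) n 5)"
proof -
  let ?d = "\<lambda>v. card (out_nbrs T n v)"
  let ?f = "\<lambda>v. (?d v choose 4) + (card (out_nbrs (dual T) n v) choose 4)"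
  have f: "?f v = (?d v choose 4) + ((2 * k - ?d v) choose 4)" "?d v \<le> 2 * k" if "v < n" for v
  proof -
    have "card (out_nbrs (dual T) n v) = 2 * k - ?d v" "?d v \<le> 2 * k"
      using card_out_plus_in[OF T that] n by auto
    then show "?f v = (?d v choose 4) + ((2 * k - ?d v) choose 4)" "?d v \<le> 2 * k" by simp_all
  qed
  have sum: "card (sourced_sets T n 5) + card (sourced_sets (dual T) n 5) = (\<Sum>v<n. ?f v)"
    using card_sourced_sets[OF T, of 4] card_sourced_sets[OF tournament_dual[OF T], of 4]
    by (simp add: numeral_eq_Suc sum.distrib)
  have le: "2 * (k choose 4) \<le> ?f v" if "v < n" for v
    using choose_4_convex(1)[OF f(2)[OF that] k] f(1)[OF that] by simp
  have "2 * (n * (k choose 4)) = (\<Sum>v<n. 2 * (k choose 4))" by simp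
  also have "\<dots> \<le> (\<Sum>v<n. ?f v)" by (rule sum_mono) (simp add: le)
  finally show "2 * (n * (k choose 4)) \<le> card (sourced_sets T n 5) + card (sourced_sets (dual T) n 5)"
    unfolding sum .
  assume "\<exists>v<n. ?d v \<noteq> k"
  then obtain v where v: "v < n" "?d v \<noteq> k" by blast
  have "2 * (k choose 4) < ?f v"
    using choose_4_convex(2)[OF f(2)[OF v(1)] k v(2)] f(1)[OF v(1)] by simp
  then have "(\<Sum>v<n. 2 * (k choose 4)) < (\<Sum>v<n. ?f v)"
    using v(1) le by (intro sum_strict_mono_ex1) auto
  then show "2 * (n * (k choose 4)) < card (sourced_sets T n 5) + card (sourced_sets (dual T) n 5)"
    unfolding sum by simp
qed

lemma card_non_strong_sets_ge:
  assumes T: "tournament n T" and n: "n = 2 * k + 1" and k: "3 \<le> k"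
  shows "n * (k choose 4) \<le> card (non_strong_sets T n)"
    and "card (non_strong_sets T n) = n * (k choose 4) \<Longrightarrow>
      (\<forall>v<n. card (out_nbrs T n v) = k) \<and> sourced_sets T n 5 = sourced_sets (dual T) n 5"
proof -
  have sub: "sourced_sets T n 5 \<subseteq> non_strong_sets T n"
    "sourced_sets (dual T) n 5 \<subseteq> non_strong_sets T n"
    using non_strong_sets_eq[OF T] by auto
  have le: "card (sourced_sets T n 5) \<le> card (non_strong_sets T n)"
    "card (sourced_sets (dual T) n 5) \<le> card (non_strong_sets T n)"
    using card_mono[OF finite_non_strong_sets] sub by blast+
  then show "n * (k choose 4) \<le> card (non_strong_sets T n)"
    using card_sourced_sets_plus_dual_ge(1)[OF assms] by linarith
  assume eq: "card (non_strong_sets T n) = n * (k choose 4)"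
  then have "\<forall>v<n. card (out_nbrs T n v) = k"
    using card_sourced_sets_plus_dual_ge(2)[OF assms] le by fastforce
  moreover have "card (sourced_sets T n 5) = card (non_strong_sets T n)"
    "card (sourced_sets (dual T) n 5) = card (non_strong_sets T n)"
    using card_sourced_sets_plus_dual_ge(1)[OF assms] le eq by linarith+
  then have "sourced_sets T n 5 = sourced_sets (dual T) n 5"
    using card_subset_eq[OF finite_non_strong_sets] sub by metis
  ultimately show "(\<forall>v<n. card (out_nbrs T n v) = k) \<and> sourced_sets T n 5 = sourced_sets (dual T) n 5"
    by blast
qed

definition transitive_on :: "(nat \<Rightarrow> nat \<Rightarrow> bool) \<Rightarrow> nat set \<Rightarrow> bool" where
  "transitive_on T Y \<longleftrightarrow> (\<forall>a\<in>Y. \<forall>b\<in>Y. \<forall>c\<in>Y. T a b \<longrightarrow> T b c \<longrightarrow> T a c)"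

lemma transitive_on_dual: "transitive_on (dual T) Y \<longleftrightarrow> transitive_on T Y"
  unfolding transitive_on_def by auto

definition rank :: "(nat \<Rightarrow> nat \<Rightarrow> bool) \<Rightarrow> nat set \<Rightarrow> nat \<Rightarrow> nat" where
  "rank T Y y = card {z \<in> Y. T z y}"

lemma rank_less_card:
  assumes T: "tournament n T" and Y: "Y \<subseteq> {0..<n}" and y: "y \<in> Y"
  shows "rank T Y y < card Y"
proof -
  have fin: "finite Y" using Y finite_subset by blast
  have "{z \<in> Y. T z y} \<subseteq> Y - {y}" using tournament_irrefl[OF T] Y y by auto
  then have "rank T Y y \<le> card (Y - {y})" unfolding rank_def using fin by (intro card_mono) auto
  also have "\<dots> < card Y" using fin y by (rule card_Diff1_less)
  finally show ?thesis .
qed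

lemma mem_iff_rank_less_card:
  assumes T: "tournament n T" and Y: "Y \<subseteq> {0..<n}" and D: "D \<subseteq> Y"
    and down: "\<And>z z'. z \<in> Y \<Longrightarrow> z' \<in> D \<Longrightarrow> T z z' \<Longrightarrow> z \<in> D" and y: "y \<in> Y"
  shows "y \<in> D \<longleftrightarrow> rank T Y y < card D"
proof -
  have finY: "finite Y" using Y finite_subset by blast
  have finD: "finite D" using D finY finite_subset by blast
  have "rank T Y y < card D" if "y \<in> D"
  proof -
    have "{z \<in> Y. T z y} \<subseteq> D - {y}" using down that tournament_irrefl[OF T] Y by auto
    then have "rank T Y y \<le> card (D - {y})" unfolding rank_def using finD by (intro card_mono) auto
    also have "\<dots> < card D" using finD that by (rule card_Diff1_less)
    finally show ?thesis .
  qed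
  moreover have "card D \<le> rank T Y y" if "y \<notin> D"
  proof -
    have "D \<subseteq> {z \<in> Y. T z y}"
    proof
      fix z assume "z \<in> D"
      moreover have "z < n" "y < n" using \<open>z \<in> D\<close> D Y y by auto
      ultimately have "T z y" using tournament_total[OF T] down[OF y] that D by blast
      then show "z \<in> {z \<in> Y. T z y}" using \<open>z \<in> D\<close> D by auto
    qed
    then show ?thesis unfolding rank_def using finY by (intro card_mono) auto
  qed
  ultimately show ?thesis by linarith
qed

lemma rank_less_iff:
  assumes T: "tournament n T" and Y: "Y \<subseteq> {0..<n}" and tr: "transitive_on T Y"
    and y: "y \<in> Y" "y' \<in> Y"
  shows "rank T Y y < rank T Y y' \<longleftrightarrow> T y y'"
proof -
  have "y \<in> {z \<in> Y. T z y'} \<longleftrightarrow> rank T Y y < card {z \<in> Y. T z y'}"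
  proof (rule mem_iff_rank_less_card[OF T Y _ _ y(1)])
    fix z z' assume "z \<in> Y" "z' \<in> {z \<in> Y. T z y'}" "T z z'"
    then show "z \<in> {z \<in> Y. T z y'}" using tr y(2) unfolding transitive_on_def by blast
  qed auto
  then show ?thesis using y by (simp add: rank_def)
qed

lemma transitive_on_has_source:
  assumes T: "tournament n T" and Y: "Y \<subseteq> {0..<n}" "Y \<noteq> {}" and tr: "transitive_on T Y"
  obtains s where "source_in T Y s"
proof -
  obtain s where s: "s \<in> Y" and least: "\<And>y. y \<in> Y \<Longrightarrow> rank T Y s \<le> rank T Y y"
    using Y(2) ex_has_least_nat[of "\<lambda>y. y \<in> Y" _ "rank T Y"] by blast
  have "T s y" if "y \<in> Y" "y \<noteq> s" for y
  proof (rule tournament_total[OF T])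
    show "\<not> T y s" using least[OF that(1)] rank_less_iff[OF T Y(1) tr that(1) s] by simp
  qed (use that s Y(1) in auto)
  then show ?thesis using that s unfolding source_in_def by blast
qed

lemma sourced_sets_dual_subset:
  assumes T: "tournament n T" and tr: "\<And>w. w < n \<Longrightarrow> transitive_on T (out_nbrs (dual T) n w)"
    and m: "2 \<le> m"
  shows "sourced_sets (dual T) n m \<subseteq> sourced_sets T n m"
proof
  fix S assume "S \<in> sourced_sets (dual T) n m"
  then obtain w where S: "S \<subseteq> {0..<n}" "card S = m" and w: "source_in (dual T) S w"
    unfolding sourced_sets_def by blast
  have wS: "w \<in> S" using w by (simp add: source_in_def)
  have X: "S - {w} \<subseteq> out_nbrs (dual T) n w" using w S by (auto simp: source_in_def out_nbrs_def)
  have "transitive_on T (out_nbrs (dual T) n w)" using tr wS S by auto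
  then have "transitive_on T (S - {w})" using X unfolding transitive_on_def by blast
  moreover have "card (S - {w}) \<noteq> 0" using S m wS by simp
  then have "S - {w} \<noteq> {}" by (metis card.empty)
  ultimately obtain s where s: "source_in T (S - {w}) s"
    using transitive_on_has_source[OF T, of "S - {w}"] S by blast
  then have "T s w" using X by (auto simp: source_in_def out_nbrs_def)
  with s have "source_in T S s" by (auto simp: source_in_def)
  then show "S \<in> sourced_sets T n m" using S unfolding sourced_sets_def by blast
qed

section \<open>Extremal tournaments are locally transitive\<close>

definition out_quadruples_have_sinks :: "(nat \<Rightarrow> nat \<Rightarrow> bool) \<Rightarrow> nat \<Rightarrow> bool" where
  "out_quadruples_have_sinks T n \<longleftrightarrow>
     (\<forall>u<n. \<forall>X. X \<subseteq> out_nbrs T n u \<and> card X = 4 \<longrightarrow> (\<exists>t. source_in (dual T) X t))"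

lemma out_quadruples_have_sinks_if_sourced_subset:
  assumes T: "tournament n T" and sub: "sourced_sets T n 5 \<subseteq> sourced_sets (dual T) n 5"
  shows "out_quadruples_have_sinks T n"
  unfolding out_quadruples_have_sinks_def
proof (intro allI impI)
  fix u X assume u: "u < n" and X: "X \<subseteq> out_nbrs T n u \<and> card X = 4"
  have uX: "u \<notin> X" using X tournament_irrefl[OF T u] by (auto simp: out_nbrs_def)
  have "finite X" using X by (metis card.infinite zero_neq_numeral)
  then have "insert u X \<in> sourced_sets T n 5"
    unfolding sourced_sets_def source_in_def using X u uX by (auto simp: out_nbrs_def)
  with sub obtain t where t: "source_in (dual T) (insert u X) t"
    unfolding sourced_sets_def by blast
  have "t \<noteq> u"
  proof
    assume "t = u"
    obtain x where "x \<in> X" using X by fastforce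
    then have "T x u" "T u x" "x < n"
      using t \<open>t = u\<close> uX X by (auto simp: source_in_def out_nbrs_def)
    then show False using tournament_asym[OF T u] by blast
  qed
  then show "\<exists>t. source_in (dual T) X t" using t unfolding source_in_def by auto
qed

lemma out_cycle_dominates_out_nbrs:
  assumes T: "tournament n T" and Q: "out_quadruples_have_sinks T n" and y: "y < n"
    and abc: "{a, b, c} \<subseteq> out_nbrs T n y" and cyc: "T a b" "T b c" "T c a"
    and x: "x \<in> out_nbrs T n y" "x \<notin> {a, b, c}"
  shows "T a x \<and> T b x \<and> T c x"
proof -
  have lt: "a < n" "b < n" "c < n" using abc by (auto simp: out_nbrs_def)
  then have "a \<noteq> b" "b \<noteq> c" "c \<noteq> a" using cyc tournament_irrefl[OF T] by auto
  then have "card {a, b, c, x} = 4" using x(2) by auto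
  moreover have "{a, b, c, x} \<subseteq> out_nbrs T n y" using abc x(1) by auto
  ultimately obtain t where t: "source_in (dual T) {a, b, c, x} t"
    using Q y unfolding out_quadruples_have_sinks_def by blast
  have "t \<noteq> a" "t \<noteq> b" "t \<noteq> c"
    using t cyc lt tournament_asym[OF T] \<open>a \<noteq> b\<close> \<open>b \<noteq> c\<close> \<open>c \<noteq> a\<close>
    unfolding source_in_def by (metis dual_apply insertCI)+
  then have "t = x" using t by (auto simp: source_in_def)
  then show ?thesis using t x(2) by (auto simp: source_in_def)
qed

lemma out_cycle_unique_dominator:
  assumes T: "tournament n T" and Q: "out_quadruples_have_sinks T n" and u: "u < n"
    and abc: "{a, b, c} \<subseteq> out_nbrs T n u" and cyc: "T a b" "T b c" "T c a"
    and z: "z < n" "T z a" "T z b" "T z c"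
  shows "z = u"
proof (rule ccontr)
  assume "z \<noteq> u"
  have lt: "a < n" "b < n" "c < n" and ua: "T u a" using abc by (auto simp: out_nbrs_def)
  have "z \<notin> {a, b, c}" using z tournament_irrefl[OF T] by auto
  consider "T u z" | "T z u" using tournament_total[OF T u z(1)] \<open>z \<noteq> u\<close> by blast
  then show False
  proof cases
    case 1
    then have "z \<in> out_nbrs T n u" using z(1) by (simp add: out_nbrs_def)
    then have "T a z"
      using out_cycle_dominates_out_nbrs[OF T Q u abc cyc] \<open>z \<notin> {a, b, c}\<close> by blast
    then show False using tournament_asym[OF T lt(1) z(1)] z(2) by blast
  next
    case 2
    have "u \<notin> {a, b, c}" using abc tournament_irrefl[OF T u] by (auto simp: out_nbrs_def)
    moreover have "{a, b, c} \<subseteq> out_nbrs T n z" "u \<in> out_nbrs T n z"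
      using z lt u 2 by (auto simp: out_nbrs_def)
    ultimately have "T a u" using out_cycle_dominates_out_nbrs[OF T Q z(1) _ cyc] by blast
    then show False using tournament_asym[OF T lt(1) u] ua by blast
  qed
qed

lemma out_nbrs_subset_if_out_cycle:
  assumes T: "tournament n T" and Q: "out_quadruples_have_sinks T n"
    and Q': "out_quadruples_have_sinks (dual T) n" and u: "u < n"
    and abc: "{a, b, c} \<subseteq> out_nbrs T n u" and cyc: "T a b" "T b c" "T c a"
    and x: "x \<in> out_nbrs T n u" "x \<notin> {a, b, c}"
  shows "out_nbrs T n u \<subseteq> {a, b, c, x}"
proof
  fix y assume y: "y \<in> out_nbrs T n u"
  show "y \<in> {a, b, c, x}"
  proof (cases "y \<in> {a, b, c}")
    case False
    have "T a y \<and> T b y \<and> T c y" "T a x \<and> T b x \<and> T c x"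
      using out_cycle_dominates_out_nbrs[OF T Q u abc cyc] x y False by blast+
    moreover have "x < n" "y < n" using x(1) y by (auto simp: out_nbrs_def)
    moreover from calculation have "{a, c, b} \<subseteq> out_nbrs (dual T) n x"
      using abc by (auto simp: out_nbrs_def)
    ultimately have "y = x"
      using out_cycle_unique_dominator[OF tournament_dual[OF T] Q', of x a c b y] cyc by auto
    then show ?thesis by simp
  qed auto
qed

lemma out_nbrs_of_sink_subset_in_nbrs:
  assumes T: "tournament n T" and x: "x < n"
    and m: "source_in (dual T) (out_nbrs T n x) m"
  shows "out_nbrs T n m \<subseteq> out_nbrs (dual T) n x"
proof
  fix j assume j: "j \<in> out_nbrs T n m"
  have mx: "m < n" "T x m" using m by (auto simp: source_in_def out_nbrs_def)
  have jm: "j < n" "T m j" using j by (auto simp: out_nbrs_def)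
  have "j \<noteq> x" using tournament_asym[OF T x mx(1) mx(2)] jm(2) by blast
  moreover have "\<not> T x j"
  proof
    assume "T x j"
    moreover have "j \<noteq> m" using tournament_irrefl[OF T mx(1)] jm(2) by blast
    ultimately have "T j m" using m jm(1) by (auto simp: source_in_def out_nbrs_def)
    then show False using tournament_asym[OF T mx(1) jm(1)] jm(2) by blast
  qed
  ultimately have "T j x" using tournament_total[OF T x jm(1)] by blast
  then show "j \<in> out_nbrs (dual T) n x" using jm(1) by (simp add: out_nbrs_def)
qed

text \<open>Applied to \<open>dual T\<close>, \<open>out_nbrs_subset_if_out_cycle\<close> gives \<open>N\<^sup>-(x) \<subseteq> {a, b, c, u}\<close>.
  The sink \<open>m\<close> of \<open>N\<^sup>+(x)\<close> has \<open>N\<^sup>+(m) \<subseteq> N\<^sup>-(x)\<close>, so with out-degree 4 it dominates the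
  cyclic triple and must be \<open>u\<close>, although \<open>m \<rightarrow> u\<close>.\<close>
lemma no_out_cycle_if_out_degrees_4:
  assumes T: "tournament n T" and Q: "out_quadruples_have_sinks T n"
    and Q': "out_quadruples_have_sinks (dual T) n"
    and deg: "\<And>v. v < n \<Longrightarrow> card (out_nbrs T n v) = 4" and u: "u < n"
    and abc: "{a, b, c} \<subseteq> out_nbrs T n u" and cyc: "T a b" "T b c" "T c a"
    and x: "x \<in> out_nbrs T n u" "x \<notin> {a, b, c}"
  shows False
proof -
  have lt: "a < n" "b < n" "c < n" and xn: "x < n" "T u x" using abc x by (auto simp: out_nbrs_def)
  have "T a x \<and> T b x \<and> T c x"
    using out_cycle_dominates_out_nbrs[OF T Q u abc cyc x] .
  then have "{a, c, b} \<subseteq> out_nbrs (dual T) n x" "u \<in> out_nbrs (dual T) n x" "u \<notin> {a, c, b}"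
    using lt u xn abc tournament_irrefl[OF T u] by (auto simp: out_nbrs_def)
  then have in_x: "out_nbrs (dual T) n x \<subseteq> {a, c, b, u}"
    using out_nbrs_subset_if_out_cycle[OF tournament_dual[OF T] Q' _ xn(1)] Q cyc by simp
  obtain m where m: "source_in (dual T) (out_nbrs T n x) m"
    using Q xn(1) deg[OF xn(1)] unfolding out_quadruples_have_sinks_def by blast
  have mn: "m < n" using m by (auto simp: source_in_def out_nbrs_def)
  have "out_nbrs T n m \<subseteq> {a, c, b, u}"
    using out_nbrs_of_sink_subset_in_nbrs[OF T xn(1) m] in_x by blast
  then have "out_nbrs T n m = {a, c, b, u}"
    using deg[OF mn] by (intro card_seteq) (auto simp: card_insert_if)
  then have "T m a" "T m b" "T m c" "T m u" by (auto simp: out_nbrs_def)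
  then show False
    using out_cycle_unique_dominator[OF T Q u abc cyc mn] tournament_irrefl[OF T u] by blast
qed

lemma out_nbrs_transitive_if_quadruples_have_sinks:
  assumes T: "tournament n T" and Q: "out_quadruples_have_sinks T n"
    and Q': "out_quadruples_have_sinks (dual T) n"
    and reg: "\<And>v. v < n \<Longrightarrow> card (out_nbrs T n v) = k" and k: "4 \<le> k" and u: "u < n"
  shows "transitive_on T (out_nbrs T n u)"
  unfolding transitive_on_def
proof (intro ballI impI)
  fix a b c assume "a \<in> out_nbrs T n u" "b \<in> out_nbrs T n u" "c \<in> out_nbrs T n u"
    and ab: "T a b" and bc: "T b c"
  then have abc: "{a, b, c} \<subseteq> out_nbrs T n u" by simp
  have lt: "a < n" "b < n" "c < n" using abc by (auto simp: out_nbrs_def)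
  show "T a c"
  proof (rule ccontr)
    assume "\<not> T a c"
    moreover have "a \<noteq> c" using ab bc tournament_asym[OF T lt(1) lt(2)] by blast
    ultimately have ca: "T c a" using tournament_total[OF T lt(1) lt(3)] by blast
    have "card {a, b, c} \<le> 3" by (simp add: card_insert_if)
    then have "card {a, b, c} < card (out_nbrs T n u)" using reg[OF u] k by simp
    then obtain x where x: "x \<in> out_nbrs T n u" "x \<notin> {a, b, c}"
      using abc by (metis card_mono finite.intros subsetI not_le)
    have "out_nbrs T n u \<subseteq> {a, b, c, x}"
      by (rule out_nbrs_subset_if_out_cycle[OF T Q Q' u abc ab bc ca x])
    moreover have "card {a, b, c, x} \<le> 4" by (simp add: card_insert_if)
    ultimately have "k \<le> 4" using reg[OF u] card_mono[of "{a, b, c, x}" "out_nbrs T n u"] by simp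
    then have "card (out_nbrs T n v) = 4" if "v < n" for v using k reg[OF that] by simp
    then show False using no_out_cycle_if_out_degrees_4[OF T Q Q' _ u abc ab bc ca x] by blast
  qed
qed

lemma rlt_iff:
  assumes n: "odd n" and i: "i < n" and j: "j < n"
  shows "rlt n i j \<longleftrightarrow> (i < j \<and> j \<le> i + (n - 1) div 2) \<or> (j < i \<and> j + (n - 1) div 2 < i)"
proof -
  have h: "n = 2 * ((n - 1) div 2) + 1" using n by simp
  show ?thesis
  proof (cases "i \<le> j")
    case True
    then have "(j + n - i) mod n = (j - i) mod n" by (metis add_diff_assoc2 mod_add_self2)
    also have "\<dots> = j - i" using j by (simp add: less_imp_diff_less)
    finally show ?thesis unfolding rlt_def using True h by linarith
  next
    case False
    then have "(j + n - i) mod n = j + n - i" using i by simp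
    then show ?thesis unfolding rlt_def using False h i by linarith
  qed
qed

lemma rlt_tournament:
  assumes "odd n"
  shows "tournament n (rlt n)"
  unfolding tournament_def using assms by (auto simp: rlt_iff)

lemma rlt_out_degree:
  assumes n: "n = 2 * k + 1" and v: "v < n"
  shows "card (out_nbrs (rlt n) n v) = k"
proof (cases "v \<le> k")
  case True
  then have "out_nbrs (rlt n) n v = {v<..v + k}"
    using n v by (auto simp: out_nbrs_def rlt_iff)
  then show ?thesis by simp
next
  case False
  then have "out_nbrs (rlt n) n v = {v<..<n} \<union> {..<v - k}"
    using n v by (auto simp: out_nbrs_def rlt_iff)
  moreover have "{v<..<n} \<inter> {..<v - k} = {}" by auto
  ultimately show ?thesis using False n v by (simp add: card_Un_disjoint)
qed

lemma rlt_out_nbrs_transitive: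
  assumes n: "odd n" and v: "v < n"
  shows "transitive_on (rlt n) (out_nbrs (rlt n) n v)"
  unfolding transitive_on_def
proof (intro ballI impI)
  fix a b c assume abc: "a \<in> out_nbrs (rlt n) n v" "b \<in> out_nbrs (rlt n) n v"
    "c \<in> out_nbrs (rlt n) n v" and ab: "rlt n a b" and bc: "rlt n b c"
  define pos where "pos x = (if v < x then x else x + n)" for x
  have rlt_pos: "rlt n x y \<longleftrightarrow> pos x < pos y"
    if "x \<in> out_nbrs (rlt n) n v" "y \<in> out_nbrs (rlt n) n v" for x y
    using that v n unfolding pos_def by (auto simp: out_nbrs_def rlt_iff)
  show "rlt n a c" using rlt_pos abc ab bc by (meson less_trans)
qed

section \<open>Regular locally transitive tournaments are isomorphic to \<open>RLT\<^sub>n\<close>\<close>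

lemma tiso_if_hom:
  assumes T: "tournament n T" and U: "tournament n U"
    and f: "\<And>x. x < n \<Longrightarrow> f x < n"
    and hom: "\<And>x y. x < n \<Longrightarrow> y < n \<Longrightarrow> T x y \<Longrightarrow> U (f x) (f y)"
  shows "tiso n T U"
proof -
  have arc: "T x y \<longleftrightarrow> U (f x) (f y)" if xy: "x < n" "y < n" for x y
  proof
    assume "U (f x) (f y)"
    show "T x y"
    proof (rule ccontr)
      assume "\<not> T x y"
      then have "x = y \<or> T y x" using tournament_total[OF T xy] by blast
      then show False
        using \<open>U (f x) (f y)\<close> hom[OF xy(2,1)] tournament_irrefl[OF U] tournament_asym[OF U] f xy
        by blast
    qed
  qed (rule hom[OF xy])
  have "inj_on f {0..<n}"
  proof (rule inj_onI)
    fix x y assume "x \<in> {0..<n}" "y \<in> {0..<n}" "f x = f y"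
    then show "x = y"
      using arc tournament_total[OF T] tournament_irrefl[OF U] f by (metis atLeastLessThan_iff)
  qed
  moreover from this have "f ` {0..<n} = {0..<n}"
    using f by (intro endo_inj_surj) auto
  ultimately have "bij_betw f {0..<n} {0..<n}" by (simp add: bij_betw_def)
  then show ?thesis unfolding tiso_def iso_on_def using arc by auto
qed

text \<open>Only out-neighbourhoods are assumed to be transitive; for regular tournaments the
  in-neighbourhoods then are transitive as well (lemma \<open>in_nbrs_transitive\<close>).\<close>
locale regular_locally_transitive =
  fixes n k :: nat and T :: "nat \<Rightarrow> nat \<Rightarrow> bool"
  assumes tournament_T: "tournament n T" and order: "n = 2 * k + 1"
    and out_degree: "\<And>v. v < n \<Longrightarrow> card (out_nbrs T n v) = k"
    and out_transitive: "\<And>v. v < n \<Longrightarrow> transitive_on T (out_nbrs T n v)"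
begin

lemma order_pos: "0 < n"
  using order by simp

lemma in_nbrs_transitive:
  assumes v: "v < n"
  shows "transitive_on T (out_nbrs (dual T) n v)"
proof (cases "out_nbrs T n v = {}")
  case True
  then have "k = 0" using out_degree[OF v] by (metis card.empty)
  then have "out_nbrs (dual T) n v = {}"
    using card_out_plus_in[OF tournament_T v] order by simp
  then show ?thesis by (simp add: transitive_on_def)
next
  case False
  moreover have "transitive_on (dual T) (out_nbrs T n v)"
    using out_transitive[OF v] by (simp add: transitive_on_dual)
  moreover have "out_nbrs T n v \<subseteq> {0..<n}" by (auto simp: out_nbrs_def)
  ultimately obtain m where m: "source_in (dual T) (out_nbrs T n v) m"
    using transitive_on_has_source[OF tournament_dual[OF tournament_T]] by blast
  have mn: "m < n" using m by (simp add: source_in_def out_nbrs_def)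
  have "out_nbrs T n m = out_nbrs (dual T) n v"
  proof (rule card_subset_eq)
    show "out_nbrs T n m \<subseteq> out_nbrs (dual T) n v"
      by (rule out_nbrs_of_sink_subset_in_nbrs[OF tournament_T v m])
    show "card (out_nbrs T n m) = card (out_nbrs (dual T) n v)"
      using card_out_plus_in[OF tournament_T v] out_degree[OF v] out_degree[OF mn] order by simp
  qed simp
  then show ?thesis using out_transitive[OF mn] by simp
qed

text \<open>The out-neighbours of \<open>w \<in> N\<^sup>+(v)\<close> in \<open>N\<^sup>-(v)\<close> are closed downwards: if \<open>z \<rightarrow> z'\<close> and
  \<open>w \<rightarrow> z'\<close> but \<open>z \<rightarrow> w\<close>, then \<open>w \<rightarrow> z' \<rightarrow> v\<close> in the transitive \<open>N\<^sup>+(z)\<close> would give \<open>w \<rightarrow> v\<close>,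
  against \<open>v \<rightarrow> w\<close>.
  By regularity there are \<open>rank w + 1\<close> of them.\<close>
lemma arc_out_in_iff_rank:
  assumes v: "v < n" and w: "w \<in> out_nbrs T n v" and z: "z \<in> out_nbrs (dual T) n v"
  shows "T w z \<longleftrightarrow> rank T (out_nbrs (dual T) n v) z \<le> rank T (out_nbrs T n v) w"
proof -
  note T = tournament_T
  let ?W = "out_nbrs T n v" and ?Z = "out_nbrs (dual T) n v"
  let ?D = "{x \<in> ?Z. T w x}"
  have wn: "w < n" "T v w" using w by (auto simp: out_nbrs_def)
  have Zn: "?Z \<subseteq> {0..<n}" and Wn: "?W \<subseteq> {0..<n}" by (auto simp: out_nbrs_def)
  have split: "out_nbrs T n w = {x \<in> ?W. T w x} \<union> ?D"
    using tournament_total[OF T v] tournament_asym[OF T wn(1) v] wn by (auto simp: out_nbrs_def)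
  have "{x \<in> ?W. T w x} \<inter> ?D = {}" using tournament_asym[OF T v] by (auto simp: out_nbrs_def)
  moreover have "card (out_nbrs T n w) = k" using out_degree[OF wn(1)] .
  ultimately have "k = card {x \<in> ?W. T w x} + card ?D"
    using split card_Un_disjoint[of "{x \<in> ?W. T w x}" ?D] by simp
  moreover have "card {x \<in> ?W. T w x} + rank T ?W w = k - 1"
    using card_out_plus_in_within[OF T Wn w] out_degree[OF v] by (simp add: rank_def)
  moreover have "0 < k" using out_degree[OF v] w by (metis card_gt_0_iff empty_iff finite_out_nbrs)
  ultimately have cardD: "card ?D = rank T ?W w + 1" by linarith
  have "z \<in> ?D \<longleftrightarrow> rank T ?Z z < card ?D"
  proof (rule mem_iff_rank_less_card[OF T Zn _ _ z])
    fix x x' assume x: "x \<in> ?Z" and x': "x' \<in> ?D" and "T x x'"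
    show "x \<in> ?D"
    proof (rule ccontr)
      assume "x \<notin> ?D"
      have xn: "x < n" "T x v" using x by (auto simp: out_nbrs_def)
      then have "x \<noteq> w" using tournament_asym[OF T v wn(1)] wn(2) by blast
      then have "T x w" using tournament_total[OF T wn(1) xn(1)] \<open>x \<notin> ?D\<close> x by blast
      then have "{w, x', v} \<subseteq> out_nbrs T n x" using x' xn \<open>T x x'\<close> wn v by (auto simp: out_nbrs_def)
      moreover have "T w x'" "T x' v" using x' by (auto simp: out_nbrs_def)
      ultimately have "T w v" using out_transitive[OF xn(1)] unfolding transitive_on_def by blast
      then show False using tournament_asym[OF T v wn(1)] wn(2) by blast
    qed
  qed auto
  then show ?thesis using z cardD by auto
qed

definition position :: "nat \<Rightarrow> nat" where
  "position x = (if x = 0 then 0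
     else if T 0 x then 1 + rank T (out_nbrs T n 0) x else k + 1 + rank T (out_nbrs (dual T) n 0) x)"

lemma position_out_nbr:
  assumes x: "x \<in> out_nbrs T n 0"
  shows "position x = 1 + rank T (out_nbrs T n 0) x" and "rank T (out_nbrs T n 0) x < k"
proof -
  note n0 = order_pos
  have "T 0 x" using x by (simp add: out_nbrs_def)
  moreover from this have "x \<noteq> 0" using tournament_irrefl[OF tournament_T n0] by metis
  ultimately show "position x = 1 + rank T (out_nbrs T n 0) x" by (simp add: position_def)
  have "out_nbrs T n 0 \<subseteq> {0..<n}" by (auto simp: out_nbrs_def)
  then show "rank T (out_nbrs T n 0) x < k"
    using rank_less_card[OF tournament_T _ x] out_degree[OF n0] by simp
qed

lemma position_in_nbr:
  assumes x: "x \<in> out_nbrs (dual T) n 0"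
  shows "position x = k + 1 + rank T (out_nbrs (dual T) n 0) x"
    and "rank T (out_nbrs (dual T) n 0) x < k"
proof -
  note n0 = order_pos
  have "T x 0" "x < n" using x by (simp_all add: out_nbrs_def)
  then have "x \<noteq> 0" "\<not> T 0 x"
    using tournament_irrefl[OF tournament_T n0] tournament_asym[OF tournament_T _ n0] by metis+
  then show "position x = k + 1 + rank T (out_nbrs (dual T) n 0) x" by (simp add: position_def)
  have "card (out_nbrs (dual T) n 0) = k"
    using card_out_plus_in[OF tournament_T n0] out_degree[OF n0] order by simp
  moreover have "out_nbrs (dual T) n 0 \<subseteq> {0..<n}" by (auto simp: out_nbrs_def)
  ultimately show "rank T (out_nbrs (dual T) n 0) x < k"
    using rank_less_card[OF tournament_T _ x] by simp
qed

lemma vertex_cases: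
  assumes "x < n"
  obtains "x = 0" | "x \<in> out_nbrs T n 0" | "x \<in> out_nbrs (dual T) n 0"
  using tournament_total[OF tournament_T _ assms, of 0] order assms by (auto simp: out_nbrs_def)

lemma position_less:
  assumes "x < n"
  shows "position x < n"
  using assms
proof (cases rule: vertex_cases)
  case 2
  then show ?thesis using position_out_nbr[OF 2] order by linarith
next
  case 3
  then show ?thesis using position_in_nbr[OF 3] order by linarith
qed (simp add: position_def order_pos)

lemma arc_cases:
  assumes "x < n" "y < n" "T x y"
  obtains "x = 0" "y \<in> out_nbrs T n 0"
    | "x \<in> out_nbrs T n 0" "y \<in> out_nbrs T n 0"
    | "x \<in> out_nbrs T n 0" "y \<in> out_nbrs (dual T) n 0"
    | "x \<in> out_nbrs (dual T) n 0" "y = 0"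
    | "x \<in> out_nbrs (dual T) n 0" "y \<in> out_nbrs T n 0"
    | "x \<in> out_nbrs (dual T) n 0" "y \<in> out_nbrs (dual T) n 0"
proof -
  have "x = 0 \<or> x \<in> out_nbrs T n 0 \<or> x \<in> out_nbrs (dual T) n 0"
    "y = 0 \<or> y \<in> out_nbrs T n 0 \<or> y \<in> out_nbrs (dual T) n 0"
    using vertex_cases[OF assms(1)] vertex_cases[OF assms(2)] by blast+
  then show ?thesis
    using that assms tournament_irrefl[OF tournament_T] tournament_asym[OF tournament_T]
    by (auto simp: out_nbrs_def)
qed

lemma rlt_position:
  assumes xy: "x < n" "y < n" "T x y"
  shows "rlt n (position x) (position y)"
proof -
  note T = tournament_T and n0 = order_pos
  let ?W = "out_nbrs T n 0" and ?Z = "out_nbrs (dual T) n 0"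
  have Wn: "?W \<subseteq> {0..<n}" and Zn: "?Z \<subseteq> {0..<n}" by (auto simp: out_nbrs_def)
  have rl: "rlt n (position x) (position y) \<longleftrightarrow> (position x < position y \<and> position y \<le> position x + k)
      \<or> (position y < position x \<and> position y + k < position x)"
    using rlt_iff[OF _ position_less[OF xy(1)] position_less[OF xy(2)]] order by auto
  from xy show ?thesis
  proof (cases rule: arc_cases)
    case 1
    then show ?thesis using rl position_out_nbr[OF 1(2)] by (simp add: position_def)
  next
    case 2
    then show ?thesis
      using rl position_out_nbr[OF 2(1)] position_out_nbr[OF 2(2)]
        rank_less_iff[OF T Wn out_transitive[OF n0] 2] xy(3) by simp
  next
    case 3
    then show ?thesis
      using rl position_out_nbr[OF 3(1)] position_in_nbr[OF 3(2)] arc_out_in_iff_rank[OF n0 3] xy(3)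
      by simp
  next
    case 4
    then show ?thesis using rl position_in_nbr[OF 4(1)] by (simp add: position_def)
  next
    case 5
    have "\<not> T y x" using tournament_asym[OF T xy(1,2,3)] .
    then show ?thesis
      using rl position_out_nbr[OF 5(2)] position_in_nbr[OF 5(1)] arc_out_in_iff_rank[OF n0 5(2,1)]
      by simp
  next
    case 6
    then show ?thesis
      using rl position_in_nbr[OF 6(1)] position_in_nbr[OF 6(2)]
        rank_less_iff[OF T Zn in_nbrs_transitive[OF n0] 6] xy(3) by simp
  qed
qed

theorem tiso_rlt: "tiso n T (rlt n)"
proof -
  have "tournament n (rlt n)" using order by (intro rlt_tournament) simp
  from tournament_T this position_less rlt_position show ?thesis by (rule tiso_if_hom)
qed

end

lemma regular_locally_transitive_rlt:
  assumes "n = 2 * k + 1"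
  shows "regular_locally_transitive n k (rlt n)"
proof
  show "tournament n (rlt n)" using assms by (intro rlt_tournament) simp
  show "card (out_nbrs (rlt n) n v) = k" if "v < n" for v by (rule rlt_out_degree[OF assms that])
  show "transitive_on (rlt n) (out_nbrs (rlt n) n v)" if "v < n" for v
    using assms that by (intro rlt_out_nbrs_transitive) simp_all
qed (rule assms)

lemma s5_rlt:
  assumes n: "n = 2 * k + 1"
  shows "s5 n (rlt n) + n * (k choose 4) = n choose 5"
proof -
  interpret regular_locally_transitive n k "rlt n"
    by (rule regular_locally_transitive_rlt[OF n])
  have "non_strong_sets (rlt n) n = sourced_sets (rlt n) n 5"
    using non_strong_sets_eq[OF tournament_T] in_nbrs_transitive
      sourced_sets_dual_subset[OF tournament_T, of 5] by auto
  then have "card (non_strong_sets (rlt n) n) = n * (k choose 4)"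
    using card_sourced_sets[OF tournament_T, of 4] by (simp add: out_degree)
  then show ?thesis using s5_plus_card_non_strong_sets by metis
qed

definition s5_bound :: "nat \<Rightarrow> real" where
  "s5_bound n = (real n + 1) * real n * (real n - 1) * (real n - 3) * (11 * real n - 47) / 1920"

lemma s5_bound_eq:
  assumes "n = 2 * k + 1"
  shows "s5_bound n = real (n choose 5) - real n * real (k choose 4)"
proof -
  have "real n = 2 * real k + 1" using assms by simp
  then show ?thesis unfolding s5_bound_def real_choose_4 real_choose_5 by (simp add: field_simps)
qed

lemma s5_upper_bound:
  assumes "tournament n T" and "n = 2 * k + 1" and "3 \<le> k"
  shows "s5 n T + n * (k choose 4) \<le> n choose 5"
  using card_non_strong_sets_ge(1)[OF assms] s5_plus_card_non_strong_sets[of n T] by linarith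

theorem tiso_rlt_if_s5_eq:
  assumes T: "tournament n T" and n: "n = 2 * k + 1" and k: "4 \<le> k"
    and eq: "s5 n T + n * (k choose 4) = n choose 5"
  shows "tiso n T (rlt n)"
proof -
  have "card (non_strong_sets T n) = n * (k choose 4)"
    using eq s5_plus_card_non_strong_sets[of n T] by linarith
  then have reg: "\<And>v. v < n \<Longrightarrow> card (out_nbrs T n v) = k"
    and sourced: "sourced_sets T n 5 = sourced_sets (dual T) n 5"
    using card_non_strong_sets_ge(2)[OF T n] k by auto
  have "out_quadruples_have_sinks T n" "out_quadruples_have_sinks (dual T) n"
    using out_quadruples_have_sinks_if_sourced_subset[OF T]
      out_quadruples_have_sinks_if_sourced_subset[OF tournament_dual[OF T]] sourced
    by simp_all
  then have "regular_locally_transitive n k T"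
    using out_nbrs_transitive_if_quadruples_have_sinks[OF T _ _ reg k]
    by (intro regular_locally_transitive.intro[OF T n reg]) blast
  then show ?thesis by (rule regular_locally_transitive.tiso_rlt)
qed

lemma s5_extremal_odd:
  assumes "odd n" and "9 \<le> n"
  shows "(\<forall>T. tournament n T \<longrightarrow> real (s5 n T) \<le> s5_bound n)
    \<and> real (s5 n (rlt n)) = s5_bound n
    \<and> (\<forall>T. tournament n T \<and> real (s5 n T) = s5_bound n \<longrightarrow> tiso n T (rlt n))"
proof -
  obtain k where n: "n = 2 * k + 1" using \<open>odd n\<close> oddE by blast
  have k: "4 \<le> k" using \<open>9 \<le> n\<close> n by simp
  have le_iff: "real s \<le> s5_bound n \<longleftrightarrow> s + n * (k choose 4) \<le> n choose 5" for s
    unfolding s5_bound_eq[OF n] of_nat_le_iff[symmetric, where 'a = real] by (simp add: le_diff_eq)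
  have eq_iff: "real s = s5_bound n \<longleftrightarrow> s + n * (k choose 4) = n choose 5" for s
    unfolding s5_bound_eq[OF n] of_nat_eq_iff[symmetric, where 'a = real] by (simp add: eq_diff_eq)
  show ?thesis
    using s5_upper_bound[OF _ n] s5_rlt[OF n] tiso_rlt_if_s5_eq[OF _ n k] k le_iff eq_iff by auto
qed

section \<open>Order 7\<close>

lemma s5_eq_choose_if_degrees_less_4:
  assumes T: "tournament n T"
    and out: "\<And>v. v < n \<Longrightarrow> card (out_nbrs T n v) < 4"
    and "in": "\<And>v. v < n \<Longrightarrow> card (out_nbrs (dual T) n v) < 4"
  shows "s5 n T = n choose 5"
proof -
  have "card (sourced_sets T n 5) = 0" "card (sourced_sets (dual T) n 5) = 0"
    using card_sourced_sets[OF T, of 4] card_sourced_sets[OF tournament_dual[OF T], of 4] out "in"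
    by (auto intro!: sum.neutral binomial_eq_0)
  then have "card (non_strong_sets T n) = 0"
    using non_strong_sets_eq[OF T] card_Un_le[of "sourced_sets T n 5" "sourced_sets (dual T) n 5"]
    by simp
  then show ?thesis using s5_plus_card_non_strong_sets[of n T] by simp
qed

lemma regular_7_s5_max:
  assumes "regular 7 T"
  shows "s5_max 7 T"
proof -
  have T: "tournament 7 T" and out: "\<And>v. v < 7 \<Longrightarrow> card (out_nbrs T 7 v) = 3"
    using assms by (auto simp: regular_def out_nbrs_def)
  have "card (out_nbrs (dual T) 7 v) = 3" if "v < 7" for v
    using card_out_plus_in[OF T that] out[OF that] by simp
  then have "s5 7 T = 7 choose 5" using s5_eq_choose_if_degrees_less_4[OF T] out by simp
  moreover have "s5 7 U \<le> 7 choose 5" for U using s5_plus_card_non_strong_sets[of 7 U] by simp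
  ultimately show ?thesis unfolding s5_max_def using T by simp
qed

lemma all_less_iff_list_all: "(\<forall>i<n. P i) \<longleftrightarrow> list_all P [0..<n]"
  by (auto simp: list_all_iff)

lemma card_less_iff_filter: "card {j. j < n \<and> P j} = length (filter P [0..<n])"
  by (simp add: length_filter_conv_card cong: conj_cong)

definition paley7 :: "nat \<Rightarrow> nat \<Rightarrow> bool" where
  "paley7 i j \<longleftrightarrow> (j + 7 - i) mod 7 \<in> {1, 2, 4}"

lemma paley7_doubly_regular: "doubly_regular 7 paley7"
proof -
  have "tournament 7 paley7"
    unfolding tournament_def all_less_iff_list_all by (simp add: paley7_def upt_rec)
  moreover have out: "\<forall>v<7. card {j. j < 7 \<and> paley7 v j} = 3"
    unfolding all_less_iff_list_all card_less_iff_filter by (simp add: paley7_def upt_rec)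
  moreover have "\<forall>v<7. \<forall>u<7. paley7 v u \<longrightarrow> card {w. w < 7 \<and> paley7 v w \<and> paley7 u w} = 1"
    unfolding all_less_iff_list_all card_less_iff_filter by (simp add: paley7_def upt_rec)
  ultimately show ?thesis
    unfolding doubly_regular_def regular_def Let_def by simp
qed

definition kotzig7 :: "nat \<Rightarrow> nat \<Rightarrow> bool" where
  "kotzig7 x y \<longleftrightarrow>
     (if x < 6 \<and> y < 6 then delta_tt2 x y
      else if x = 6 then y \<in> {0, 2, 4} else y = 6 \<and> x \<in> {1, 3, 5})"

lemma kotzig7_kotzig: "kotzig 7 kotzig7"
proof -
  have "regular 7 kotzig7"
    unfolding regular_def tournament_def all_less_iff_list_all card_less_iff_filter
    by (simp add: kotzig7_def delta_tt2_def upt_rec)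
  moreover have "{0..<7} - {6} = {0..<6::nat}" by auto
  then have "iso_on ({0..<7} - {6}) kotzig7 {0..<6::nat} delta_tt2"
    unfolding iso_on_def by (intro exI[of _ id]) (auto simp: kotzig7_def)
  ultimately show ?thesis unfolding kotzig_def by force
qed

theorem proposition1:
  shows "(\<forall>n::nat. odd n \<and> n \<ge> 9 \<longrightarrow>
            (\<forall>T. tournament n T \<longrightarrow>
               real (s5 n T) \<le> (real n + 1) * real n * (real n - 1) * (real n - 3) * (11 * real n - 47) / 1920)
          \<and> real (s5 n (rlt n)) = (real n + 1) * real n * (real n - 1) * (real n - 3) * (11 * real n - 47) / 1920
          \<and> (\<forall>T. tournament n T \<and>
               real (s5 n T) = (real n + 1) * real n * (real n - 1) * (real n - 3) * (11 * real n - 47) / 1920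
               \<longrightarrow> tiso n T (rlt n)))
       \<and> s5_max 7 (rlt 7)
       \<and> (\<exists>T. doubly_regular 7 T) \<and> (\<forall>T. doubly_regular 7 T \<longrightarrow> s5_max 7 T)
       \<and> (\<exists>T. kotzig 7 T) \<and> (\<forall>T. kotzig 7 T \<longrightarrow> s5_max 7 T)"
proof -
  have "regular 7 (rlt 7)"
    using rlt_tournament[of 7] rlt_out_degree[of 7 3] by (simp add: regular_def out_nbrs_def)
  then show ?thesis
    unfolding s5_bound_def[symmetric]
    using s5_extremal_odd regular_7_s5_max paley7_doubly_regular kotzig7_kotzig
    by (auto simp: doubly_regular_def kotzig_def)
qed

end
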